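(* The generating function $A(x,w,q|0)=\sum_{i\ge1}\sum_{t\ge1}\sum_{n\ge t}a_i(n,0,t)\,x^nw^tq^i$ is given by $$A(x,w,q|0)=\frac{q\sum_{j\ge0}\dfrac{w\sqrt{x}\,q^{j}}{\left(U_{j+1}(t)-w\sqrt{x}\,U_j(t)\right)\left(U_{j}(t)-w\sqrt{x}\,U_{j-1}(t)\right)}}{(1-q)\left(1+q\sum_{j\ge0}\dfrac{q^{j}}{\sqrt{x}\,U_{j+2}(t)U_{j+1}(t)}\right)},$$ where on the right-hand side $t=\frac{1}{2\sqrt{x}}$.
   Context: For a positive integer $n$, $\mathcal{L}_n$ denotes the set of all words $a=(a_1,a_2,\ldots,a_n)$ over the alphabet of non-negative integers satisfying: (i) $a_{i+1}\ge a_i-1$ for $1\le i<n$; and (ii) if $a_i=k>0$ with $i$ minimal (i.e. $i$ is the position of the left-most occurrence of the letter $k$), then there exist $i_1<i<i_2$ such that $a_{i_1}=a_{i_2}=k-1$. For $i\ge1$ and $1\le t\le n$, $a_i(n,0,t)$ is the number of words in $\mathcal{L}_n$ containing no letter equal to $i$ and containing exactly $t$ zeros. (The paper's sum over $i$ starts at $i=0$, with the $i=0$ term defined to be $0$.) $U_n$ are the Chebyshev polynomials of the second kind: $U_0(y)=1$, $U_1(y)=2y$, $U_n(y)=2yU_{n-1}(y)-U_{n-2}(y)$ for $n\ge2$, with $U_{-1}(y)=0$ (extending the recurrence). Identities are of formal series in $x$ and $q$ (expansions taken in powers of $\sqrt{x}$, the infinite sums converging in that sense). *)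

theory Defs
  imports "HOL-Computational_Algebra.Computational_Algebra"
begin

text \<open>Words are lists, so positions are counted from 0 instead of 1.\<close>

definition L_words :: "nat \<Rightarrow> nat list set" where
  "L_words n = {a. length a = n \<and>
     (\<forall>i. i + 1 < n \<longrightarrow> int (a ! (i + 1)) \<ge> int (a ! i) - 1) \<and>
     (\<forall>i k. i < n \<and> a ! i = k \<and> k > 0 \<and> (\<forall>j<i. a ! j \<noteq> k) \<longrightarrow>
        (\<exists>i1 i2. i1 < i \<and> i < i2 \<and> i2 < n \<and> a ! i1 = k - 1 \<and> a ! i2 = k - 1))}"

text \<open>
  \<open>a_count i n t\<close> is the number usually written $a_i(n,0,t)$: the words of length \<open>n\<close> in which the
  letter \<open>i\<close> does not occur and the letter 0 occurs exactly \<open>t\<close> times.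
\<close>

definition a_count :: "nat \<Rightarrow> nat \<Rightarrow> nat \<Rightarrow> nat" where
  "a_count i n t = card {a \<in> L_words n. i \<notin> set a \<and> count_list a 0 = t}"

fun cheb_U_nat :: "nat \<Rightarrow> 'a::comm_ring_1 \<Rightarrow> 'a" where
  "cheb_U_nat 0 y = 1"
| "cheb_U_nat (Suc 0) y = 2 * y"
| "cheb_U_nat (Suc (Suc n)) y = 2 * y * cheb_U_nat (Suc n) y - cheb_U_nat n y"

text \<open>
  The index is an integer because $U_{-1} = 0$ is needed; indices below $-1$ are never used.
\<close>

definition cheb_U :: "int \<Rightarrow> 'a::comm_ring_1 \<Rightarrow> 'a" where
  "cheb_U n y = (if n < 0 then 0 else cheb_U_nat (nat n) y)"

text \<open>
  The ambient field consists of the Laurent series in $\sqrt{x}$ whose coefficients are Laurent series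
  in $w$ over the Laurent series in $q$. Its topology (that of the outermost \<open>fls\<close>) is the
  $\sqrt{x}$-adic one, with discrete coefficients: this is the sense in which infinite
  sums of elements of this field converge.
\<close>

type_synonym series = "rat fls fls fls"

definition sqrt_x :: series where "sqrt_x = fls_X"
definition var_w :: series where "var_w = fls_const fls_X"
definition var_q :: series where "var_q = fls_const (fls_const fls_X)"

text \<open>
  The generating function $\sum_{i \ge 1} \sum_{t \ge 1} \sum_{n \ge t} a_i(n,0,t) x^n w^t q^i$.
  The sum over $i$ is not finite for fixed $n$ and $t$, so the series is given by its coefficients.
  It is first written as a power series in $x$, and the composition with the second power then
  substitutes $x = (\sqrt{x})^2$.
\<close>

definition A_gf :: series where
  "A_gf = fls_compose_power (fps_to_fls (Abs_fps (\<lambda>n.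
            fps_to_fls (Abs_fps (\<lambda>t.
              fps_to_fls (Abs_fps (\<lambda>i.
                if i \<ge> 1 \<and> t \<ge> 1 \<and> n \<ge> t then of_nat (a_count i n t) else 0))))))) 2"

end

theory Submission
  imports Defs
begin

text \<open>
  Removing all zeros from a word and lowering every other letter by 1 yields a word of the same kind,
  and the letter \<open>i + 1\<close> is avoided before if and only if \<open>i\<close> is avoided afterwards
  (\<open>words_eq_UN_extensions\<close>). Conversely, zeros may be inserted at the front and after every 1, that is,
  after every zero of the smaller word, and the requirement on the left-most 1 asks for at least one
  zero at the front and at least one elsewhere. So a non-empty word with \<open>s\<close> zeros has as many
  extensions with \<open>t\<close> zeros as the coefficient of \<open>y^t\<close> in \<open>y / (1 - y) * (1 / (1 - y)^s - 1)\<close>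
  (\<open>card_extensions\<close>).

  Write \<open>A(v)\<close> for the generating function with the variable \<open>w\<close> replaced by \<open>v\<close>. Summed over all words,
  the insertion of zeros becomes the functional equation (\<open>eval_gf_functional_equation\<close>)

  \<open>A(v) = q * x v / (1 - x v) * (A(1 / (1 - x v)) + E)\<close> with \<open>E = 1 / (1 - q) - A(1)\<close>,

  where \<open>1 / (1 - q) = 1 + q + ...\<close> counts the empty word, which avoids every letter. Iterating this
  equation moves \<open>v\<close> along the orbit \<open>v_0 = v\<close>, \<open>v_(k+1) = 1 / (1 - x v_k)\<close>, and every step
  contributes a factor \<open>q x v_k v_(k+1)\<close>, so the remainder vanishes in the limit
  (\<open>functional_equation_sums\<close>). With \<open>D_k = U_k - v sqrt(x) U_(k-1)\<close> at \<open>1 / (2 sqrt(x))\<close>, one has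
  \<open>sqrt(x) v_k = D_(k-1) / D_k\<close>; the products telescope (\<open>telescoping_product\<close>) and give

  \<open>A(v) = E q S(v)\<close> with \<open>S(v) = \<Sum>j. v sqrt(x) q^j / (D_j D_(j+1))\<close>.

  At \<open>v = 1\<close>, \<open>D_k = sqrt(x) U_(k+1)\<close>, so \<open>S(1)\<close> is the series in the denominator of the formula. From
  \<open>E + A(1) = 1 / (1 - q)\<close> it follows that \<open>(1 - q) (1 + q S(1)) = 1 / E\<close>, and \<open>v = w\<close> gives the
  formula.
\<close>

section \<open>Words in terms of prefixes and suffixes\<close>

text \<open>
  The positional condition on left-most occurrences, rewritten with \<^const>\<open>takeWhile\<close> and
  \<^const>\<open>dropWhile\<close>: these functions commute with deleting and relabelling letters, whereas
  positions do not. The suffix begins with the letter \<open>Suc k\<close> itself, which is harmless because only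
  membership of the different letter \<open>k\<close> is asked.
\<close>

definition nested :: "nat list \<Rightarrow> bool" where
  "nested a \<longleftrightarrow> (\<forall>k. Suc k \<in> set a \<longrightarrow>
     k \<in> set (takeWhile (\<lambda>x. x \<noteq> Suc k) a) \<and> k \<in> set (dropWhile (\<lambda>x. x \<noteq> Suc k) a))"

abbreviation slow_descent :: "nat list \<Rightarrow> bool" where
  "slow_descent \<equiv> successively (\<lambda>x y. x \<le> Suc y)"

lemma in_take_drop_iff:
  assumes "i < length a" "a ! i \<noteq> k"
  shows "k \<in> set (take i a) \<and> k \<in> set (drop i a) \<longleftrightarrow>
    (\<exists>i1 i2. i1 < i \<and> i < i2 \<and> i2 < length a \<and> a ! i1 = k \<and> a ! i2 = k)"
proof -
  have "k \<in> set (take i a) \<longleftrightarrow> (\<exists>i1<i. a ! i1 = k)"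
    using assms(1) by (auto simp: in_set_conv_nth)
  moreover have "k \<in> set (drop i a) \<longleftrightarrow> (\<exists>i2>i. i2 < length a \<and> a ! i2 = k)"
  proof
    assume "k \<in> set (drop i a)"
    then obtain j where j: "j < length a - i" "a ! (i + j) = k"
      by (auto simp: in_set_conv_nth)
    then have "j \<noteq> 0" using assms(2) by (cases j) auto
    with j show "\<exists>i2>i. i2 < length a \<and> a ! i2 = k"
      by (intro exI[of _ "i + j"]) auto
  next
    assume "\<exists>i2>i. i2 < length a \<and> a ! i2 = k"
    then obtain i2 where "i2 > i" "i2 < length a" "a ! i2 = k" by blast
    then show "k \<in> set (drop i a)"
      by (auto simp: in_set_conv_nth intro!: exI[of _ "i2 - i"])
  qed
  ultimately show ?thesis by blast
qed

lemma nested_iff_nth: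
  "nested a \<longleftrightarrow> (\<forall>i k. i < length a \<and> a ! i = k \<and> k > 0 \<and> (\<forall>j<i. a ! j \<noteq> k) \<longrightarrow>
     (\<exists>i1 i2. i1 < i \<and> i < i2 \<and> i2 < length a \<and> a ! i1 = k - 1 \<and> a ! i2 = k - 1))"
  (is "_ \<longleftrightarrow> ?R")
proof
  assume N: "nested a"
  show ?R
  proof (intro allI impI)
    fix i k assume *: "i < length a \<and> a ! i = k \<and> k > 0 \<and> (\<forall>j<i. a ! j \<noteq> k)"
    then obtain l where l: "k = Suc l" by (cases k) auto
    have t: "takeWhile (\<lambda>x. x \<noteq> k) a = take i a"
      using * by (intro takeWhile_eq_take_P_nth) auto
    have "dropWhile (\<lambda>x. x \<noteq> k) a = drop i a"
      using t * by (metis dropWhile_eq_drop length_take min.absorb4)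
    moreover have "k \<in> set a" using * by auto
    ultimately show "\<exists>i1 i2. i1 < i \<and> i < i2 \<and> i2 < length a \<and> a ! i1 = k - 1 \<and> a ! i2 = k - 1"
      using N t l * in_take_drop_iff[of i a l] unfolding nested_def by auto
  qed
next
  assume R: ?R
  show "nested a" unfolding nested_def
  proof (intro allI impI)
    fix k assume "Suc k \<in> set a"
    define i where "i = length (takeWhile (\<lambda>x. x \<noteq> Suc k) a)"
    have "i < length a"
    proof (rule ccontr)
      assume "\<not> i < length a"
      then have "takeWhile (\<lambda>x. x \<noteq> Suc k) a = a"
        unfolding i_def by (metis linorder_not_less take_all takeWhile_eq_take)
      with \<open>Suc k \<in> set a\<close> show False by (metis (mono_tags) set_takeWhileD)
    qed
    moreover have "a ! i = Suc k"
      using nth_length_takeWhile[of "\<lambda>x. x \<noteq> Suc k" a] \<open>i < length a\<close> unfolding i_def by auto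
    moreover have "\<forall>j<i. a ! j \<noteq> Suc k"
      unfolding i_def using set_takeWhileD[of _ "\<lambda>x. x \<noteq> Suc k" a] nth_mem takeWhile_nth by metis
    ultimately have "k \<in> set (take i a) \<and> k \<in> set (drop i a)"
      using R[rule_format, of i "Suc k"] in_take_drop_iff[of i a k] by auto
    then show "k \<in> set (takeWhile (\<lambda>x. x \<noteq> Suc k) a) \<and> k \<in> set (dropWhile (\<lambda>x. x \<noteq> Suc k) a)"
      unfolding i_def by (metis dropWhile_eq_drop takeWhile_eq_take)
  qed
qed

lemma L_words_iff: "a \<in> L_words n \<longleftrightarrow> length a = n \<and> slow_descent a \<and> nested a"
proof -
  have "slow_descent a \<longleftrightarrow> (\<forall>i. i + 1 < length a \<longrightarrow> int (a ! (i + 1)) \<ge> int (a ! i) - 1)"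
    unfolding successively_conv_nth by (auto simp: algebra_simps)
  then show ?thesis unfolding L_words_def nested_iff_nth by auto
qed

section \<open>Stripping the zeros of a word\<close>

text \<open>
  The letter at position 0 has nothing before it, so it cannot be positive.
\<close>

lemma nested_hd:
  assumes "nested a" "a \<noteq> []"
  shows "hd a = 0"
proof (cases "hd a")
  case (Suc k)
  with assms have "k \<in> set (takeWhile (\<lambda>x. x \<noteq> Suc k) a)"
    unfolding nested_def by (metis list.set_sel(1))
  with Suc assms show ?thesis by (cases a) auto
qed

lemma takeWhile_filter_neq:
  "P k \<Longrightarrow> takeWhile (\<lambda>x. x \<noteq> k) (filter P a) = filter P (takeWhile (\<lambda>x. x \<noteq> k) a)"
  by (induction a) auto

lemma dropWhile_filter_neq:
  "P k \<Longrightarrow> dropWhile (\<lambda>x. x \<noteq> k) (filter P a) = filter P (dropWhile (\<lambda>x. x \<noteq> k) a)"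
  by (induction a) auto

text \<open>
  The part of \<^const>\<open>nested\<close> that concerns the letter 1; it is what becomes invisible when
  the zeros are removed.
\<close>

definition one_enclosed :: "nat list \<Rightarrow> bool" where
  "one_enclosed a \<longleftrightarrow> (1 \<in> set a \<longrightarrow>
     0 \<in> set (takeWhile (\<lambda>x. x \<noteq> 1) a) \<and> 0 \<in> set (dropWhile (\<lambda>x. x \<noteq> 1) a))"

text \<open>
  The requirement on the letter \<open>k + 2\<close> only involves the letters \<open>k + 1\<close> and \<open>k + 2\<close>, both of which
  survive, so it is the requirement on the letter \<open>k + 1\<close> of the stripped word.
\<close>

lemma nested_strip_zeros:
  assumes "filter ((<) 0) a = map Suc c"
  shows "nested a \<longleftrightarrow> nested c \<and> one_enclosed a"
proof -
  have mem: "Suc k \<in> set a \<longleftrightarrow> k \<in> set c" for k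
  proof -
    have "Suc k \<in> set a \<longleftrightarrow> Suc k \<in> set (filter ((<) 0) a)" by simp
    then show ?thesis unfolding assms by auto
  qed
  have tk: "Suc l \<in> set (takeWhile (\<lambda>x. x \<noteq> Suc k) a) \<longleftrightarrow> l \<in> set (takeWhile (\<lambda>x. x \<noteq> k) c)" for k l
  proof -
    have "Suc l \<in> set (takeWhile (\<lambda>x. x \<noteq> Suc k) a) \<longleftrightarrow>
        Suc l \<in> set (filter ((<) 0) (takeWhile (\<lambda>x. x \<noteq> Suc k) a))" by simp
    also have "\<dots> \<longleftrightarrow> Suc l \<in> set (takeWhile (\<lambda>x. x \<noteq> Suc k) (map Suc c))"
      by (subst takeWhile_filter_neq[symmetric]) (simp_all add: assms)
    finally show ?thesis by (auto simp: takeWhile_map o_def)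
  qed
  have dk: "Suc l \<in> set (dropWhile (\<lambda>x. x \<noteq> Suc k) a) \<longleftrightarrow> l \<in> set (dropWhile (\<lambda>x. x \<noteq> k) c)" for k l
  proof -
    have "Suc l \<in> set (dropWhile (\<lambda>x. x \<noteq> Suc k) a) \<longleftrightarrow>
        Suc l \<in> set (filter ((<) 0) (dropWhile (\<lambda>x. x \<noteq> Suc k) a))" by simp
    also have "\<dots> \<longleftrightarrow> Suc l \<in> set (dropWhile (\<lambda>x. x \<noteq> Suc k) (map Suc c))"
      by (subst dropWhile_filter_neq[symmetric]) (simp_all add: assms)
    finally show ?thesis by (auto simp: dropWhile_map o_def)
  qed
  have all_split: "(\<forall>k. P k) \<longleftrightarrow> P 0 \<and> (\<forall>k. P (Suc k))" for P :: "nat \<Rightarrow> bool"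
    by (metis not0_implies_Suc)
  show ?thesis
    unfolding nested_def one_enclosed_def by (subst all_split) (auto simp: mem tk dk)
qed

text \<open>
  A zero may only follow a letter that is at most 1. The flag says whether the letter in front of the
  word allows a zero, so that the condition can be tested from left to right.
\<close>

fun zeros_fit :: "bool \<Rightarrow> nat list \<Rightarrow> bool" where
  "zeros_fit p [] \<longleftrightarrow> True"
| "zeros_fit p (x # xs) \<longleftrightarrow> (x = 0 \<longrightarrow> p) \<and> zeros_fit (x \<le> 1) xs"

text \<open>
  A letter followed by a zero is at most 1, and from there every letter can follow. Hence the zeros
  between two positive letters never hide a forbidden descent, and \<open>zeros_fit\<close> is all that gets lost
  when they are removed. The leading letter \<open>x\<close> is general so that the induction can pass over zeros.
\<close>

lemma slow_descent_Cons_filter: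
  "slow_descent (x # a) \<longleftrightarrow> zeros_fit (x \<le> 1) a \<and> slow_descent (x # filter ((<) 0) a)"
proof (induction a arbitrary: x)
  case (Cons y a)
  show ?case
  proof (cases "y = 0")
    case True
    then show ?thesis using Cons[of 0] by (auto simp: successively_Cons)
  qed (use Cons[of y] in auto)
qed simp

lemma slow_descent_strip_zeros:
  assumes "filter ((<) 0) a = map Suc c"
  shows "slow_descent a \<longleftrightarrow> slow_descent c \<and> zeros_fit True a"
proof -
  have "slow_descent a \<longleftrightarrow> slow_descent (0 # a)" by (auto simp: successively_Cons)
  also have "\<dots> \<longleftrightarrow> zeros_fit True a \<and> slow_descent (0 # map Suc c)"
    by (simp add: slow_descent_Cons_filter[of 0 a] assms)
  also have "slow_descent (0 # map Suc c) \<longleftrightarrow> slow_descent c"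
    by (auto simp: successively_Cons successively_map)
  finally show ?thesis by auto
qed

section \<open>Counting the ways to insert zeros\<close>

text \<open>
  The flag is carried along so that fillings can be built letter by letter: it is \<open>False\<close> when \<open>c\<close> is
  what remains of a word after a letter that must not be followed by a zero.
\<close>

definition fillings :: "bool \<Rightarrow> nat list \<Rightarrow> nat \<Rightarrow> nat list set" where
  "fillings p c t =
     {a. filter ((<) 0) a = map Suc c \<and> count_list a 0 = t \<and> zeros_fit p a}"

lemma length_strip_zeros:
  assumes "filter ((<) 0) a = map Suc c"
  shows "length a = length c + count_list a 0"
proof -
  have "length a = length (filter ((<) 0) a) + count_list a (0::nat)"
    by (induction a) auto
  then show ?thesis unfolding assms by simp
qed

lemma set_strip_zeros:
  assumes "filter ((<) 0) a = map Suc c"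
  shows "set a \<subseteq> insert 0 (Suc ` set c)" "Suc i \<in> set a \<longleftrightarrow> i \<in> set c"
proof -
  have *: "set (filter ((<) 0) a) = Suc ` set c" unfolding assms by simp
  then show "set a \<subseteq> insert 0 (Suc ` set c)" by auto
  have "Suc i \<in> set a \<longleftrightarrow> Suc i \<in> Suc ` set c" unfolding *[symmetric] by simp
  then show "Suc i \<in> set a \<longleftrightarrow> i \<in> set c" by auto
qed

lemma finite_fillings: "finite (fillings p c t)"
proof (rule finite_subset)
  show "fillings p c t \<subseteq> {a. set a \<subseteq> insert 0 (Suc ` set c) \<and> length a = length c + t}"
    unfolding fillings_def using length_strip_zeros set_strip_zeros(1) by blast
qed (simp add: finite_lists_length_eq)

lemma fillings_False_Nil: "fillings False [] t = (if t = 0 then {[]} else {})"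
proof -
  have *: "filter ((<) 0) a = [] \<and> zeros_fit False a \<longleftrightarrow> a = []" for a
    by (cases a) auto
  have "fillings False [] t = {a. (filter ((<) 0) a = [] \<and> zeros_fit False a) \<and> count_list a 0 = t}"
    unfolding fillings_def by auto
  also have "\<dots> = (if t = 0 then {[]} else {})" unfolding * by auto
  finally show ?thesis .
qed

lemma count_list_replicate_same: "count_list (replicate n x) x = n"
  by (induction n) auto

lemma fillings_True_Nil: "fillings True [] t = {replicate t 0}"
proof -
  have "a = replicate (count_list a 0) 0" if "filter ((<) 0) a = []" for a :: "nat list"
    using that by (induction a) (auto split: if_splits)
  moreover have "zeros_fit True (replicate t 0)"
    by (induction t) auto
  ultimately show ?thesis unfolding fillings_def by (auto simp: count_list_replicate_same)
qed

lemma fillings_False_Cons: "fillings False (d # c) t = (#) (Suc d) ` fillings (d = 0) c t"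
proof (intro equalityI subsetI)
  fix a assume "a \<in> fillings False (d # c) t"
  then show "a \<in> (#) (Suc d) ` fillings (d = 0) c t"
    by (cases a) (auto simp: fillings_def split: if_splits)
qed (auto simp: fillings_def)

lemma fillings_True_Cons:
  "fillings True (d # c) t = (#) (Suc d) ` fillings (d = 0) c t \<union>
     (if t = 0 then {} else (#) 0 ` fillings True (d # c) (t - 1))"
proof (intro equalityI subsetI)
  fix a assume "a \<in> fillings True (d # c) t"
  then show "a \<in> (#) (Suc d) ` fillings (d = 0) c t \<union>
     (if t = 0 then {} else (#) 0 ` fillings True (d # c) (t - 1))"
    by (cases a) (auto simp: fillings_def split: if_splits)
qed (auto simp: fillings_def split: if_splits)

lemma card_fillings_True_Cons:
  "card (fillings True (d # c) t) = card (fillings (d = 0) c t) +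
     (if t = 0 then 0 else card (fillings True (d # c) (t - 1)))"
proof (cases "t = 0")
  case False
  then have "card (fillings True (d # c) t) =
      card ((#) (Suc d) ` fillings (d = 0) c t \<union> (#) 0 ` fillings True (d # c) (t - 1))"
    by (subst fillings_True_Cons) simp
  also have "\<dots> = card ((#) (Suc d) ` fillings (d = 0) c t) + card ((#) 0 ` fillings True (d # c) (t - 1))"
    by (rule card_Un_disjoint) (auto simp: finite_fillings)
  finally show ?thesis using False by (simp add: card_image)
qed (subst fillings_True_Cons, simp add: card_image)

lemma card_fillings_False_Cons:
  "card (fillings False (d # c) t) = card (fillings (d = 0) c t)"
  by (simp add: fillings_False_Cons card_image)

text \<open>
  Zeros can be inserted independently after each 1, which is a zero of \<open>c\<close>, and, if the flag permits,
  in front. Each of these places contributes one geometric series.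
\<close>

lemma fillings_gf:
  "Abs_fps (\<lambda>t. of_nat (card (fillings p c t)) :: 'a::field) =
     inverse (1 - fps_X) ^ (count_list c 0 + (if p then 1 else 0))"
proof (induction c arbitrary: p)
  case Nil
  show ?case
  proof (cases p)
    case True
    then show ?thesis by (simp add: fillings_True_Nil fps_inverse_one_minus_fps_X)
  next
    case False
    then show ?thesis by (auto simp: fillings_False_Nil fps_eq_iff)
  qed
next
  case (Cons d c)
  let ?G = "\<lambda>p c. Abs_fps (\<lambda>t. of_nat (card (fillings p c t)) :: 'a)"
  show ?case
  proof (cases p)
    case True
    have "?G True (d # c) = ?G (d = 0) c + fps_X * ?G True (d # c)"
      by (rule fps_ext, subst fps_nth_Abs_fps, subst card_fillings_True_Cons) simp
    then have "(1 - fps_X) * ?G True (d # c) = ?G (d = 0) c" by (simp add: algebra_simps)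
    moreover have "inverse (1 - fps_X) * (1 - fps_X) = (1 :: 'a fps)"
      by (rule inverse_mult_eq_1) simp
    ultimately have "?G True (d # c) = inverse (1 - fps_X) * ?G (d = 0) c"
      by (metis mult.assoc mult_1)
    then show ?thesis using True by (simp add: Cons)
  next
    case False
    then show ?thesis by (simp add: card_fillings_False_Cons Cons)
  qed
qed

text \<open>
  If \<open>c\<close> is an admissible word, these are exactly the admissible words with \<open>t\<close> zeros that become \<open>c\<close>
  when their zeros are stripped.
\<close>

definition extensions :: "nat list \<Rightarrow> nat \<Rightarrow> nat list set" where
  "extensions c t = {a \<in> fillings True c t. one_enclosed a}"

text \<open>
  For a word with \<open>s > 0\<close> zeros, the fillings are restricted in two ways. At least one inserted zero is
  in front, which gives the factor \<open>y / (1 - y)\<close>; at least one is after the left-most 1, which removes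
  the constant term of \<open>1 / (1 - y)^s\<close>. For \<open>s = 0\<close> the word is empty and only the first
  restriction remains, in the form that at least one zero is inserted.
\<close>

definition insertion_gf :: "nat \<Rightarrow> 'a::field fps" where
  "insertion_gf s = fps_X * inverse (1 - fps_X) *
     (inverse (1 - fps_X) ^ s - (if s = 0 then 0 else 1))"

lemma extensions_Nil: "extensions [] t = {replicate t 0}"
  unfolding extensions_def fillings_True_Nil one_enclosed_def by auto

lemma zeros_fit_replicate: "zeros_fit True (replicate f 0 @ a) = zeros_fit True a"
  by (induction f) auto

text \<open>
  The left-most 1 comes from the leading zero of the stripped word. It splits an extension into a
  block of \<open>f\<close> zeros and an arbitrary filling of the rest, and both sides must contain a zero.
\<close>

lemma extensions_Cons:
  "extensions (0 # c) t = (\<Union>f\<in>{1..<t}. (\<lambda>b. replicate f 0 @ 1 # b) ` fillings True c (t - f))"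
proof (intro equalityI subsetI)
  fix a assume a: "a \<in> extensions (0 # c) t"
  then have "filter ((<) 0) a = 1 # map Suc c" unfolding extensions_def fillings_def by simp
  then obtain u b where ub: "a = u @ 1 # b" "\<forall>x\<in>set u. x = 0" "map Suc c = filter ((<) 0) b"
    unfolding filter_eq_Cons_iff by auto
  define f where "f = length u"
  have u: "u = replicate f 0" using ub(2) unfolding f_def by (metis replicate_length_same)
  have t: "t = f + count_list b 0" using a
    unfolding extensions_def fillings_def ub(1) u by (auto simp: count_list_replicate_same)
  have zf: "zeros_fit True b"
    using a unfolding extensions_def fillings_def ub(1) u by (auto simp: zeros_fit_replicate)
  have tw: "takeWhile (\<lambda>x. x \<noteq> 1) a = u" and dw: "dropWhile (\<lambda>x. x \<noteq> 1) a = 1 # b"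
    using ub(1,2) by (auto simp: takeWhile_append dropWhile_append)
  have "one_enclosed a" using a by (simp add: extensions_def)
  then have "0 \<in> set u" "0 \<in> set b"
    unfolding one_enclosed_def tw dw by (auto simp: ub(1))
  then have "f \<noteq> 0" "count_list b 0 \<noteq> 0" by (auto simp: u count_list_0_iff)
  then have "f \<in> {1..<t}" "b \<in> fillings True c (t - f)"
    using ub(3) zf unfolding fillings_def t by auto
  then show "a \<in> (\<Union>f\<in>{1..<t}. (\<lambda>b. replicate f 0 @ 1 # b) ` fillings True c (t - f))"
    using ub(1) u by blast
next
  fix a assume "a \<in> (\<Union>f\<in>{1..<t}. (\<lambda>b. replicate f 0 @ 1 # b) ` fillings True c (t - f))"
  then obtain f b where f: "1 \<le> f" "f < t" and a: "a = replicate f 0 @ 1 # b"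
    and b: "b \<in> fillings True c (t - f)" by auto
  have "0 \<in> set b" using b f count_notin[of 0 b] unfolding fillings_def by (cases "0 \<in> set b") auto
  then have "one_enclosed a"
    using f by (auto simp: one_enclosed_def a takeWhile_append dropWhile_append)
  then show "a \<in> extensions (0 # c) t"
    using b f unfolding extensions_def fillings_def
    by (auto simp: a zeros_fit_replicate count_list_replicate_same)
qed

lemma card_extensions_Cons:
  "card (extensions (0 # c) t) = (\<Sum>f\<in>{1..<t}. card (fillings True c (t - f)))"
proof -
  have "f = f'" if "replicate f 0 @ (1::nat) # b = replicate f' 0 @ 1 # b'" for f f' b b'
  proof -
    have "takeWhile (\<lambda>x. x = 0) (replicate f 0 @ (1::nat) # b) =
          takeWhile (\<lambda>x. x = 0) (replicate f' 0 @ 1 # b')" using that by simp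
    then show ?thesis by (auto simp: takeWhile_append split: if_splits)
  qed
  note disj = this
  have "card (extensions (0 # c) t) =
      (\<Sum>f\<in>{1..<t}. card ((\<lambda>b. replicate f 0 @ 1 # b) ` fillings True c (t - f)))"
    unfolding extensions_Cons
    by (rule card_UN_disjoint) (simp, simp add: finite_fillings, use disj in blast)
  then show ?thesis by (simp add: card_image inj_on_def)
qed

lemma card_extensions:
  assumes "nested c" "t > 0"
  shows "of_nat (card (extensions c t)) = fps_nth (insertion_gf (count_list c 0) :: 'a::field fps) t"
proof (cases c)
  case Nil
  with assms(2) show ?thesis
    by (simp add: extensions_Nil insertion_gf_def fps_inverse_one_minus_fps_X)
next
  case (Cons d c')
  with nested_hd[OF assms(1)] have c: "c = 0 # c'" by simp
  define H where "H = inverse (1 - fps_X) ^ Suc (count_list c' 0) - (1 :: 'a fps)"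
  have H: "fps_nth H m = (if m = 0 then 0 else of_nat (card (fillings True c' m)))" for m
  proof -
    have "H = Abs_fps (\<lambda>t. of_nat (card (fillings True c' t))) - 1"
      unfolding H_def by (simp add: fillings_gf)
    moreover have "fps_nth H 0 = 0"
      by (simp add: H_def fps_power_zeroth)
    ultimately show ?thesis by simp
  qed
  have "fps_nth (insertion_gf (count_list c 0) :: 'a fps) t =
     fps_nth (inverse (1 - fps_X) * H) (t - 1)"
    using assms(2) by (simp add: insertion_gf_def c H_def mult.assoc)
  also have "\<dots> = (\<Sum>i=0..t-1. fps_nth H (t - 1 - i))"
    by (simp add: fps_inverse_one_minus_fps_X fps_mult_nth)
  also have "\<dots> = (\<Sum>f\<in>{1..t}. fps_nth H (t - f))"
    using assms(2) by (intro sum.reindex_bij_witness[of _ "\<lambda>f. f - 1" Suc]) auto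
  also have "\<dots> = (\<Sum>f\<in>{1..<t}. fps_nth H (t - f))"
    using assms(2) by (intro sum.mono_neutral_right) (auto simp: H)
  also have "\<dots> = (\<Sum>f\<in>{1..<t}. of_nat (card (fillings True c' (t - f))))"
    by (intro sum.cong) (auto simp: H)
  finally show ?thesis by (simp add: c card_extensions_Cons)
qed

section \<open>The recurrence for the numbers of words\<close>

text \<open>
  Together with a letter, a word contains all smaller ones, so its letters are bounded by its length.
\<close>

lemma finite_L_words_avoiding: "finite {c \<in> L_words n. P c}"
proof -
  have "k \<le> length a" if "nested a" "k \<in> set a" for k and a :: "nat list"
  proof -
    have "{..k} \<subseteq> set a"
    proof
      fix j assume "j \<in> {..k}"
      then have "j \<le> k" by simp
      then show "j \<in> set a" using \<open>k \<in> set a\<close>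
      proof (induction rule: inc_induct)
        case (step j)
        then show ?case using \<open>nested a\<close> unfolding nested_def by (meson set_takeWhileD)
      qed
    qed
    then have "card {..k} \<le> card (set a)" by (intro card_mono) auto
    then show ?thesis using card_length[of a] by simp
  qed
  then have "L_words n \<subseteq> {a. set a \<subseteq> {..n} \<and> length a = n}"
    by (auto simp: L_words_iff)
  then show ?thesis
    by (intro finite_subset[OF _ finite_lists_length_eq[of "{..n}" n]]) auto
qed

lemma words_eq_UN_extensions:
  assumes "t \<le> n"
  shows "{a \<in> L_words n. Suc i \<notin> set a \<and> count_list a 0 = t} =
     (\<Union>c\<in>{c \<in> L_words (n - t). i \<notin> set c}. extensions c t)"
proof (intro equalityI subsetI)
  fix a assume a: "a \<in> {a \<in> L_words n. Suc i \<notin> set a \<and> count_list a 0 = t}"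
  define c where "c = map (\<lambda>x. x - 1) (filter ((<) 0) a)"
  have "map Suc c = map (\<lambda>x. x) (filter ((<) 0) a)"
    unfolding c_def by (auto simp: comp_def intro!: map_idI)
  then have c: "filter ((<) 0) a = map Suc c" by simp
  have "c \<in> L_words (n - t)" "i \<notin> set c" "a \<in> extensions c t"
    using a length_strip_zeros[OF c] nested_strip_zeros[OF c] slow_descent_strip_zeros[OF c]
      set_strip_zeros(2)[OF c] c
    by (auto simp: L_words_iff extensions_def fillings_def)
  then show "a \<in> (\<Union>c\<in>{c \<in> L_words (n - t). i \<notin> set c}. extensions c t)" by blast
next
  fix a assume "a \<in> (\<Union>c\<in>{c \<in> L_words (n - t). i \<notin> set c}. extensions c t)"
  then obtain c where c: "c \<in> L_words (n - t)" "i \<notin> set c" "a \<in> extensions c t" by auto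
  then have f: "filter ((<) 0) a = map Suc c" by (auto simp: extensions_def fillings_def)
  show "a \<in> {a \<in> L_words n. Suc i \<notin> set a \<and> count_list a 0 = t}"
    using c length_strip_zeros[OF f] nested_strip_zeros[OF f] slow_descent_strip_zeros[OF f]
      set_strip_zeros(2)[OF f] assms
    by (auto simp: L_words_iff extensions_def fillings_def)
qed

text \<open>
  The number of extensions depends on the word only through its number \<open>s\<close> of zeros, so the
  word \<open>0 ... 0\<close> can serve as representative. Having it as a natural number makes it independent of the
  coefficient field.
\<close>

definition insertions :: "nat \<Rightarrow> nat \<Rightarrow> nat" where
  "insertions s t = card (extensions (replicate s 0) t)"

lemma insertions_gf:
  assumes "t > 0"
  shows "of_nat (insertions s t) = fps_nth (insertion_gf s :: 'a::field fps) t"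
proof -
  have "nested (replicate s 0)" by (auto simp: nested_def)
  from card_extensions[OF this assms] show ?thesis
    by (simp add: insertions_def count_list_replicate_same)
qed

lemma card_extensions_eq_insertions:
  assumes "nested c" "t > 0"
  shows "card (extensions c t) = insertions (count_list c 0) t"
proof -
  have "(of_nat (card (extensions c t)) :: rat) = of_nat (insertions (count_list c 0) t)"
    using assms by (simp add: card_extensions insertions_gf)
  then show ?thesis by simp
qed

lemma a_count_Suc:
  assumes "0 < t" "t \<le> n"
  shows "a_count (Suc i) n t = (\<Sum>s\<le>n - t. insertions s t * a_count i (n - t) s)"
proof -
  let ?C = "{c \<in> L_words (n - t). i \<notin> set c}"
  have "c = c'" if "a \<in> extensions c t" "a \<in> extensions c' t" for a c c'
    using that by (auto simp: extensions_def fillings_def dest: map_injective)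
  then have "a_count (Suc i) n t = (\<Sum>c\<in>?C. card (extensions c t))"
    unfolding a_count_def words_eq_UN_extensions[OF assms(2)]
    by (intro card_UN_disjoint)
       (auto simp: finite_L_words_avoiding extensions_def finite_fillings)
  also have "\<dots> = (\<Sum>c\<in>?C. insertions (count_list c 0) t)"
    using assms(1) by (intro sum.cong) (auto simp: L_words_iff card_extensions_eq_insertions)
  also have "\<dots> = (\<Sum>s\<le>n - t. \<Sum>c\<in>{c\<in>?C. count_list c 0 = s}. insertions (count_list c 0) t)"
  proof (rule sum.group[symmetric])
    have "count_list c 0 \<le> n - t" if "c \<in> L_words (n - t)" for c
      using that count_le_length[of c 0] by (simp add: L_words_iff)
    then show "(\<lambda>c. count_list c 0) ` ?C \<subseteq> {..n - t}" by auto
  qed (simp_all add: finite_L_words_avoiding)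
  also have "\<dots> = (\<Sum>s\<le>n - t. insertions s t * a_count i (n - t) s)"
    by (intro sum.cong) (auto simp: a_count_def conj_ac)
  finally show ?thesis .
qed

lemma a_count_avoid_0:
  assumes "t > 0"
  shows "a_count 0 n t = 0"
proof -
  have *: "{a \<in> L_words n. 0 \<notin> set a \<and> count_list a 0 = t} = {}"
    using assms by auto
  show ?thesis unfolding a_count_def * by simp
qed

lemma a_count_no_zeros: "a_count i n 0 = (if n = 0 then 1 else 0)"
proof -
  have "a = []" if "nested a" "0 \<notin> set a" for a
    using nested_hd[OF that(1)] that(2) by (metis hd_in_set)
  then have "{a \<in> L_words n. i \<notin> set a \<and> count_list a 0 = 0} = (if n = 0 then {[]} else {})"
    by (auto simp: L_words_iff count_list_0_iff nested_def)
  then show ?thesis unfolding a_count_def by simp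
qed

section \<open>Locally finite sums of power series\<close>

text \<open>
  The sum of infinitely many power series, the \<open>n\<close>-th of which has no terms of degree below \<open>n\<close>.
  In degree \<open>k\<close> only the first \<open>k + 1\<close> series contribute, so the sum can be defined without limits.
\<close>

definition fps_lsum :: "(nat \<Rightarrow> 'a::comm_ring_1 fps) \<Rightarrow> 'a fps" where
  "fps_lsum g = Abs_fps (\<lambda>k. \<Sum>n\<le>k. fps_nth (g n) k)"

definition rising :: "(nat \<Rightarrow> 'a::comm_ring_1 fps) \<Rightarrow> bool" where
  "rising g \<longleftrightarrow> (\<forall>n k. k < n \<longrightarrow> fps_nth (g n) k = 0)"

lemma fps_lsum_nth:
  assumes "rising g" "k \<le> m"
  shows "fps_nth (fps_lsum g) k = (\<Sum>n\<le>m. fps_nth (g n) k)"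
proof -
  have "(\<Sum>n\<le>k. fps_nth (g n) k) = (\<Sum>n\<le>m. fps_nth (g n) k)"
    using assms by (intro sum.mono_neutral_left) (auto simp: rising_def)
  then show ?thesis by (simp add: fps_lsum_def)
qed

lemma power_mult_nth_eq_0:
  fixes x :: "'a::comm_ring_1 fps"
  assumes "fps_nth x 0 = 0" "k < n"
  shows "fps_nth (x ^ n * f) k = 0"
  using startsby_zero_power_prefix[OF assms(1)] assms(2)
  by (auto simp: fps_mult_nth intro!: sum.neutral)

lemma fps_lsum_mult:
  assumes "rising g"
  shows "fps_lsum (\<lambda>n. f * g n) = f * fps_lsum g"
proof (rule fps_ext)
  fix k
  have "fps_nth (f * fps_lsum g) k = (\<Sum>i=0..k. fps_nth f i * (\<Sum>n\<le>k. fps_nth (g n) (k - i)))"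
    using assms by (simp add: fps_mult_nth fps_lsum_nth[of g _ k])
  also have "\<dots> = (\<Sum>n\<le>k. fps_nth (f * g n) k)"
    by (simp add: fps_mult_nth sum_distrib_left sum.swap[of _ "{..k}" "{0..k}"])
  finally show "fps_nth (fps_lsum (\<lambda>n. f * g n)) k = fps_nth (f * fps_lsum g) k"
    by (simp add: fps_lsum_def)
qed

lemma fps_lsum_add: "fps_lsum (\<lambda>n. f n + g n) = fps_lsum f + fps_lsum g"
  by (rule fps_ext) (simp add: fps_lsum_def sum.distrib)

lemma fps_lsum_diff: "fps_lsum (\<lambda>n. f n - g n) = fps_lsum f - fps_lsum g"
  by (rule fps_ext) (simp add: fps_lsum_def sum_subtractf)

lemma fps_lsum_single: "fps_lsum (\<lambda>n. if n = 0 then f else 0) = f"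
  by (rule fps_ext) (simp add: fps_lsum_def if_distrib[of "\<lambda>g. fps_nth g _"] cong: if_cong)

text \<open>
  Summing a double family along its diagonals or by rows is the same in every degree \<open>k\<close>: all
  contributions with \<open>m + t > k\<close> vanish, which makes triangle and square interchangeable.
\<close>

lemma fps_lsum_diagonal:
  assumes "\<And>m t k. k < m + t \<Longrightarrow> fps_nth (f m t) k = 0"
  shows "fps_lsum (\<lambda>n. \<Sum>m\<le>n. f m (n - m)) = fps_lsum (\<lambda>m. fps_lsum (f m))"
proof (rule fps_ext)
  fix k
  have "fps_nth (fps_lsum (\<lambda>n. \<Sum>m\<le>n. f m (n - m))) k =
      (\<Sum>n\<le>k. \<Sum>m\<le>n. fps_nth (f m (n - m)) k)"
    by (simp add: fps_lsum_def fps_sum_nth)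
  also have "\<dots> = (\<Sum>(m, t)\<in>{(m, t). m + t \<le> k}. fps_nth (f m t) k)"
    by (rule sum.triangle_reindex_eq[symmetric])
  also have "\<dots> = (\<Sum>(m, t)\<in>{..k} \<times> {..k}. fps_nth (f m t) k)"
    by (rule sum.mono_neutral_left) (auto intro!: assms)
  finally show "fps_nth (fps_lsum (\<lambda>n. \<Sum>m\<le>n. f m (n - m))) k =
      fps_nth (fps_lsum (\<lambda>m. fps_lsum (f m))) k"
    by (simp add: fps_lsum_def sum.cartesian_product)
qed

lemma fps_lsum_compose: "fps_lsum (\<lambda>t. fps_const (fps_nth a t) * b ^ t) = fps_compose a b"
  by (rule fps_ext) (simp add: fps_lsum_def fps_compose_nth atMost_atLeast0)

section \<open>The functional equation\<close>

text \<open>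
  The double series with coefficients \<open>c n t\<close>, with a power series \<open>v\<close> substituted for the variable
  that marks zeros. It is used for several values of \<open>v\<close>, which is why the substitution is built in.
\<close>

definition eval_gf :: "(nat \<Rightarrow> nat \<Rightarrow> 'a::field) \<Rightarrow> 'a fps \<Rightarrow> 'a fps \<Rightarrow> 'a fps" where
  "eval_gf c x v = fps_lsum (\<lambda>n. x ^ n * (\<Sum>t\<le>n. fps_const (c n t) * v ^ t))"

lemma rising_power: "fps_nth x 0 = 0 \<Longrightarrow> rising (\<lambda>n. x ^ n * f n)"
  by (auto simp: rising_def power_mult_nth_eq_0)

lemma insertion_gf_compose:
  fixes y :: "'a::field fps"
  assumes "fps_nth y 0 = 0"
  shows "fps_compose (insertion_gf s) y =
     y * inverse (1 - y) * (inverse (1 - y) ^ s - 1 + (if s = 0 then 1 else 0))"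
proof -
  have *: "fps_compose (inverse (1 - fps_X)) y = inverse (1 - y)"
    using assms by (subst fps_inverse_compose) (auto simp: fps_compose_sub_distrib)
  show ?thesis using assms
    by (simp add: insertion_gf_def fps_compose_mult_distrib fps_compose_sub_distrib *
        flip: fps_compose_power)
qed

lemma fps_const_sum: "fps_const (sum f A) = (\<Sum>a\<in>A. fps_const (f a))"
  by (induction A rule: infinite_finite_induct) (simp_all flip: fps_const_add)

text \<open>
  In the recurrence, a word of length \<open>m\<close> with \<open>s\<close> zeros is replaced by its extensions, which have
  \<open>t\<close> zeros and length \<open>m + t\<close>. Summing over \<open>t\<close> first replaces the weight \<open>v^s\<close> by \<open>insertion_gf s\<close>
  at \<open>x v\<close>, that is, up to the common factor \<open>x v / (1 - x v)\<close>, by the \<open>s\<close>-th powers of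
  \<open>1 / (1 - x v)\<close> minus those of 1; the correction at \<open>s = 0\<close> only concerns the empty word and yields the
  last summand.
\<close>

lemma eval_gf_functional_equation:
  fixes x v :: "'a::field fps"
  assumes x: "fps_nth x 0 = 0"
    and c0: "\<And>n. c n 0 = (if n = 0 then e else 0)"
    and c: "\<And>n t. 0 < t \<Longrightarrow> t \<le> n \<Longrightarrow>
      c n t = q * (\<Sum>s\<le>n - t. of_nat (insertions s t) * c (n - t) s)"
  shows "eval_gf c x v = fps_const e + fps_const q * (x * v * inverse (1 - x * v)) *
     (eval_gf c x (inverse (1 - x * v)) - eval_gf c x 1 + fps_const e)"
proof -
  define y where "y = x * v"
  have y0: "fps_nth y 0 = 0" using x by (simp add: y_def)
  define M where "M = inverse (1 - y)"
  \<comment> \<open>The contribution of the words of length \<open>m\<close> to which \<open>t\<close> zeros are added.\<close>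
  define f where "f m t = (\<Sum>s\<le>m. fps_const (c m s) * (x ^ m * (fps_const (fps_nth (insertion_gf s) t) * y ^ t)))" for m t
  have f0: "f m 0 = 0" for m by (simp add: f_def insertion_gf_def)
  have fvan: "fps_nth (f m t) k = 0" if "k < m + t" for m t k
  proof -
    have "f m t = x ^ (m + t) * (\<Sum>s\<le>m. fps_const (c m s) * (fps_const (fps_nth (insertion_gf s) t) * v ^ t))"
      unfolding f_def y_def by (simp add: sum_distrib_left power_add power_mult_distrib mult_ac)
    then show ?thesis using power_mult_nth_eq_0[OF x that] by simp
  qed
  have summand: "x ^ n * (\<Sum>t\<le>n. fps_const (c n t) * v ^ t) =
     (if n = 0 then fps_const e else 0) + fps_const q * (\<Sum>m\<le>n. f m (n - m))" for n
  proof -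
    have recurrence: "x ^ n * (fps_const (c n t) * v ^ t) = fps_const q * f (n - t) t" if "0 < t" "t \<le> n" for t
    proof -
      have "x ^ n = x ^ (n - t) * x ^ t" using that by (simp flip: power_add)
      moreover have "fps_const (c n t) = fps_const q *
          (\<Sum>s\<le>n - t. fps_const (fps_nth (insertion_gf s) t) * fps_const (c (n - t) s))"
        unfolding c[OF that] using that by (simp add: insertions_gf flip: fps_const_sum)
      ultimately show ?thesis
        unfolding f_def y_def
        by (simp add: sum_distrib_left sum_distrib_right power_mult_distrib mult_ac
            del: fps_const_mult)
    qed
    have "x ^ n * (\<Sum>t\<le>n. fps_const (c n t) * v ^ t) = (\<Sum>t\<le>n. x ^ n * (fps_const (c n t) * v ^ t))"
      by (simp add: sum_distrib_left)
    also have "\<dots> = x ^ n * fps_const (c n 0) + (\<Sum>t\<in>{1..n}. x ^ n * (fps_const (c n t) * v ^ t))"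
      by (simp add: atMost_atLeast0 sum.atLeast_Suc_atMost)
    also have "(\<Sum>t\<in>{1..n}. x ^ n * (fps_const (c n t) * v ^ t)) = (\<Sum>t\<in>{1..n}. fps_const q * f (n - t) t)"
      by (intro sum.cong) (auto simp: recurrence)
    also have "\<dots> = (\<Sum>t\<in>{0..n}. fps_const q * f (n - t) t)"
      by (simp add: f0 sum.atLeast_Suc_atMost)
    also have "\<dots> = (\<Sum>m\<le>n. fps_const q * f m (n - m))"
      by (intro sum.reindex_bij_witness[of _ "\<lambda>m. n - m" "\<lambda>m. n - m"]) auto
    finally show ?thesis by (simp add: c0 sum_distrib_left)
  qed
  have inner: "fps_lsum (f m) = (y * M) * (x ^ m * (\<Sum>s\<le>m. fps_const (c m s) * M ^ s)
     - x ^ m * (\<Sum>s\<le>m. fps_const (c m s) * 1 ^ s) + (if m = 0 then fps_const e else 0))" for m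
  proof -
    have "fps_lsum (f m) = (\<Sum>s\<le>m. fps_lsum (\<lambda>t. fps_const (c m s) * x ^ m * (fps_const (fps_nth (insertion_gf s) t) * y ^ t)))"
      by (rule fps_ext) (simp add: fps_lsum_def f_def fps_sum_nth sum.swap[of _ "{..m}"] mult.assoc)
    also have "\<dots> = (\<Sum>s\<le>m. fps_const (c m s) * x ^ m * fps_compose (insertion_gf s) y)"
    proof (intro sum.cong refl)
      fix s
      have "rising (\<lambda>t. fps_const (fps_nth (insertion_gf s) t) * y ^ t)"
        using rising_power[OF y0, of "\<lambda>t. fps_const (fps_nth (insertion_gf s) t)"] by (simp add: mult.commute)
      then show "fps_lsum (\<lambda>t. fps_const (c m s) * x ^ m * (fps_const (fps_nth (insertion_gf s) t) * y ^ t)) =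
          fps_const (c m s) * x ^ m * fps_compose (insertion_gf s) y"
        by (simp add: fps_lsum_mult fps_lsum_compose)
    qed
    also have "\<dots> = (y * M) * (x ^ m * (\<Sum>s\<le>m. fps_const (c m s) * M ^ s)
       - x ^ m * (\<Sum>s\<le>m. fps_const (c m s) * 1 ^ s) + x ^ m * (\<Sum>s\<le>m. fps_const (c m s) * (if s = 0 then 1 else 0)))"
      unfolding insertion_gf_compose[OF y0] M_def[symmetric]
      by (simp add: sum_distrib_left algebra_simps sum.distrib sum_subtractf)
    also have "x ^ m * (\<Sum>s\<le>m. fps_const (c m s) * (if s = 0 then 1 else 0)) = (if m = 0 then fps_const e else 0)"
      by (simp add: if_distrib[of "\<lambda>a. _ * a"] c0 cong: if_cong)
    finally show ?thesis .
  qed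
  have "eval_gf c x v = fps_const e + fps_lsum (\<lambda>n. fps_const q * (\<Sum>m\<le>n. f m (n - m)))"
    unfolding eval_gf_def summand fps_lsum_add fps_lsum_single ..
  also have "fps_lsum (\<lambda>n. fps_const q * (\<Sum>m\<le>n. f m (n - m))) = fps_const q * fps_lsum (\<lambda>n. \<Sum>m\<le>n. f m (n - m))"
    by (rule fps_lsum_mult) (auto simp: rising_def fps_sum_nth fvan)
  also have "fps_lsum (\<lambda>n. \<Sum>m\<le>n. f m (n - m)) = fps_lsum (\<lambda>m. fps_lsum (f m))"
    by (rule fps_lsum_diagonal) (rule fvan)
  also have "\<dots> = y * M * (eval_gf c x M - eval_gf c x 1 + fps_const e)"
  proof -
    have "rising (\<lambda>m. x ^ m * (\<Sum>s\<le>m. fps_const (c m s) * M ^ s)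
     - x ^ m * (\<Sum>s\<le>m. fps_const (c m s) * 1 ^ s) + (if m = 0 then fps_const e else 0))"
      using x by (auto simp: rising_def power_mult_nth_eq_0)
    then show ?thesis
      unfolding inner eval_gf_def by (subst fps_lsum_mult) (simp_all add: fps_lsum_add fps_lsum_diff fps_lsum_single)
  qed
  finally show ?thesis by (simp add: y_def M_def mult.assoc)
qed

section \<open>Iterating the functional equation\<close>

text \<open>
  The arguments that occur when the functional equation is applied again and again.
\<close>

definition orbit :: "'a::field fps \<Rightarrow> 'a fps \<Rightarrow> nat \<Rightarrow> 'a fps" where
  "orbit x v j = ((\<lambda>u. inverse (1 - x * u)) ^^ j) v"

lemma orbit_0: "orbit x v 0 = v" and orbit_Suc: "orbit x v (Suc j) = inverse (1 - x * orbit x v j)"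
  by (simp_all add: orbit_def)

text \<open>
  The product telescopes later because the fraction \<open>x u / (1 - x u)\<close> at the argument
  \<open>u = orbit x v k\<close> is \<open>x\<close> times two consecutive members of the orbit.
\<close>

lemma functional_equation_iterate:
  assumes "\<And>u. A u = q * (x * u * inverse (1 - x * u)) * (A (inverse (1 - x * u)) + E)"
  shows "A v = E * q * (\<Sum>j<J. q ^ j * (\<Prod>k\<le>j. x * orbit x v k * orbit x v (Suc k))) +
     q ^ J * (\<Prod>k<J. x * orbit x v k * orbit x v (Suc k)) * A (orbit x v J)"
proof (induction J)
  case 0
  then show ?case by (simp add: orbit_0)
next
  case (Suc J)
  have "A (orbit x v J) = q * (x * orbit x v J * orbit x v (Suc J)) * (A (orbit x v (Suc J)) + E)"
    by (subst assms) (simp add: orbit_Suc)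
  then have "A v = E * q * (\<Sum>j<J. q ^ j * (\<Prod>k\<le>j. x * orbit x v k * orbit x v (Suc k))) +
     q ^ J * (\<Prod>k<J. x * orbit x v k * orbit x v (Suc k)) *
     (q * (x * orbit x v J * orbit x v (Suc J)) * (A (orbit x v (Suc J)) + E))"
    using Suc by simp
  then show ?case by (simp add: algebra_simps flip: lessThan_Suc_atMost)
qed

text \<open>
  Convergence in the metric of formal Laurent series holds as soon as the \<open>n\<close>-th remainder
  is divisible by the \<open>n\<close>-th power of the variable.
\<close>

lemma sums_flsI:
  fixes f :: "nat \<Rightarrow> 'a::field fls"
  assumes "\<And>n. \<exists>g. L - (\<Sum>j<n. f j) = fls_X ^ n * fps_to_fls g"
  shows "f sums L"
proof -
  have bound: "dist (\<Sum>j<n. f j) L \<le> inverse (2 ^ n)" for n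
  proof (cases "(\<Sum>j<n. f j) = L")
    case False
    obtain g where g: "L - (\<Sum>j<n. f j) = fls_X ^ n * fps_to_fls g" using assms by blast
    with False have "g \<noteq> 0" by auto
    then have "fls_subdegree (L - (\<Sum>j<n. f j)) = int n + int (subdegree g)"
      unfolding g by (subst fls_subdegree_mult) (auto simp: fls_subdegree_fls_to_fps)
    with False show ?thesis
      by (subst dist_commute) (auto simp: dist_fls_def nat_add_distrib power_increasing field_simps)
  qed simp
  have lim: "(\<lambda>n. inverse (2 ^ n) :: real) \<longlonglongrightarrow> 0" by (rule LIMSEQ_inverse_realpow_zero) simp
  have "(\<lambda>n. dist (\<Sum>j<n. f j) L) \<longlonglongrightarrow> 0"
    by (rule tendsto_sandwich[OF _ _ tendsto_const lim]) (simp_all add: bound)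
  then show ?thesis unfolding sums_def by (rule tendsto_dist_iff[THEN iffD2])
qed

lemma fps_to_fls_sum: "fps_to_fls (sum f A) = (\<Sum>a\<in>A. fps_to_fls (f a))"
  by (induction A rule: infinite_finite_induct) simp_all

lemma fps_to_fls_prod:
  "fps_to_fls (prod f A) = (\<Prod>a\<in>A. fps_to_fls (f a :: 'a::comm_ring_1 fps))"
  by (induction A rule: infinite_finite_induct) (simp_all add: fls_times_fps_to_fls)

text \<open>
  After \<open>J\<close> iterations the remainder contains the factor \<open>x^J\<close>, so it tends to 0. Since \<open>q\<close> and \<open>E\<close>
  are units, the iterated equation can be divided by them before passing to the limit; this way the
  convergence of the series comes out together with its value.
\<close>

lemma functional_equation_sums:
  fixes A :: "'a::field fps \<Rightarrow> 'a fps" and q :: 'a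
  assumes x: "x = fps_X ^ 2"
    and A: "\<And>u. A u = fps_const q * (x * u * inverse (1 - x * u)) * (A (inverse (1 - x * u)) + E)"
    and E: "fps_nth E 0 \<noteq> 0" and q: "q \<noteq> 0"
  shows "(\<lambda>j. fls_const q ^ j * (\<Prod>k\<le>j. fps_to_fls (x * orbit x v k * orbit x v (Suc k)))) sums
     (fps_to_fls (A v) / (fls_const q * fps_to_fls E))"
proof (rule sums_flsI)
  fix J
  define S where "S = (\<Sum>j<J. fps_const q ^ j * (\<Prod>k\<le>j. x * orbit x v k * orbit x v (Suc k)))"
  \<comment> \<open>The remainder without the power of the variable that \<open>sums_flsI\<close> asks for; of the \<open>2 J\<close>
    available factors, \<open>J\<close> stay inside.\<close>
  define R where "R = fps_const (inverse q) * inverse E * fps_const q ^ J * fps_X ^ J *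
     (\<Prod>k<J. orbit x v k * orbit x v (Suc k)) * A (orbit x v J)"
  have "A v = E * fps_const q * S + fps_const q ^ J * (\<Prod>k<J. x * (orbit x v k * orbit x v (Suc k))) * A (orbit x v J)"
    unfolding S_def using functional_equation_iterate[of A "fps_const q" x E v J, OF A] by (simp only: mult.assoc)
  also have "(\<Prod>k<J. x * (orbit x v k * orbit x v (Suc k))) = fps_X ^ (J + J) * (\<Prod>k<J. orbit x v k * orbit x v (Suc k))"
    unfolding prod.distrib[of "\<lambda>_. x"] by (simp add: x mult_2 flip: power_mult)
  also have "E * fps_const q * S + fps_const q ^ J * (fps_X ^ (J + J) * (\<Prod>k<J. orbit x v k * orbit x v (Suc k))) * A (orbit x v J) =
      fps_const q * E * (S + fps_X ^ J * R)"
  proof -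
    have "fps_const q * fps_const (inverse q) = 1" using q by simp
    moreover have "E * inverse E = 1" using inverse_mult_eq_1[OF E] by (simp add: mult.commute)
    ultimately have "fps_const q * E * (fps_const (inverse q) * inverse E) = 1"
      by (metis mult.assoc mult.left_commute mult_1_right)
    moreover have "fps_const q * E * (S + fps_X ^ J * R) = E * fps_const q * S +
        (fps_const q * E * (fps_const (inverse q) * inverse E)) *
        (fps_const q ^ J * (fps_X ^ (J + J) * (\<Prod>k<J. orbit x v k * orbit x v (Suc k))) * A (orbit x v J))"
      unfolding R_def by (simp only: power_add distrib_left mult_ac)
    ultimately show ?thesis by simp
  qed
  finally have "fps_to_fls (A v) = fls_const q * fps_to_fls E * (fps_to_fls S + fls_X ^ J * fps_to_fls R)"
    by (simp add: fls_times_fps_to_fls fps_to_fls_power)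
  moreover have "fls_const q * fps_to_fls E \<noteq> 0" using E q by auto
  ultimately have "fps_to_fls (A v) / (fls_const q * fps_to_fls E) = fps_to_fls S + fls_X ^ J * fps_to_fls R"
    by simp
  moreover have "fps_to_fls S = (\<Sum>j<J. fls_const q ^ j * (\<Prod>k\<le>j. fps_to_fls (x * orbit x v k * orbit x v (Suc k))))"
    unfolding S_def by (simp add: fps_to_fls_sum fps_to_fls_prod fls_times_fps_to_fls fps_to_fls_power fls_const_power)
  ultimately show "\<exists>g. fps_to_fls (A v) / (fls_const q * fps_to_fls E) -
      (\<Sum>j<J. fls_const q ^ j * (\<Prod>k\<le>j. fps_to_fls (x * orbit x v k * orbit x v (Suc k)))) = fls_X ^ J * fps_to_fls g"
    by auto
qed

section \<open>Telescoping\<close>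

text \<open>
  The orbit of the Moebius map \<open>w \<mapsto> 1 / (1 - X^2 w)\<close> is linearised by the second-order recurrence
  for \<open>d\<close>: by induction \<open>X w_k = d_k / d_(k+1)\<close>, and hence \<open>X^2 w_k w_(k+1) = d_k / d_(k+2)\<close>. The
  induction shows at the same time that the denominators do not vanish, because \<open>1 - X^2 w_k\<close> is
  invertible.
\<close>

lemma telescoping_product:
  fixes X :: "'a::field" and w d :: "nat \<Rightarrow> 'a"
  assumes X: "X \<noteq> 0"
    and w: "\<And>k. w (Suc k) * (1 - X ^ 2 * w k) = 1"
    and d: "d 0 = X * w 0" "d (Suc 0) = 1" "\<And>k. d (Suc (Suc k)) = d (Suc k) / X - d k"
  shows "d (Suc k) \<noteq> 0"
    and "(\<Prod>k\<le>j. X ^ 2 * w k * w (Suc k)) = d 0 / (d (Suc j) * d (Suc (Suc j)))"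
proof -
  have main: "X * w k * d (Suc k) = d k \<and> d (Suc k) \<noteq> 0" for k
  proof (induction k)
    case 0
    then show ?case using d by simp
  next
    case (Suc k)
    have "X * d (Suc (Suc k)) = d (Suc k) - X * d k" using X by (simp add: d(3) field_simps)
    also have "\<dots> = d (Suc k) * (1 - X ^ 2 * w k)"
      using Suc by (simp add: power2_eq_square algebra_simps)
    finally have *: "X * d (Suc (Suc k)) = d (Suc k) * (1 - X ^ 2 * w k)" .
    moreover have "1 - X ^ 2 * w k \<noteq> 0" using w[of k] by auto
    ultimately have "d (Suc (Suc k)) \<noteq> 0" using Suc by (metis mult_eq_0_iff)
    moreover have "X * w (Suc k) * d (Suc (Suc k)) = d (Suc k)"
    proof -
      have "X * w (Suc k) * d (Suc (Suc k)) = w (Suc k) * (X * d (Suc (Suc k)))" by simp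
      also have "\<dots> = d (Suc k) * (w (Suc k) * (1 - X ^ 2 * w k))" unfolding * by simp
      finally show ?thesis unfolding w by simp
    qed
    ultimately show ?case by simp
  qed
  then show nz: "d (Suc k) \<noteq> 0" for k by blast
  have factor: "X ^ 2 * w k * w (Suc k) = d k / d (Suc (Suc k))" for k
  proof -
    have "X ^ 2 * w k * w (Suc k) * d (Suc (Suc k)) = X * w k * (X * w (Suc k) * d (Suc (Suc k)))"
      by (simp add: power2_eq_square)
    also have "\<dots> = d k" using main[of k] main[of "Suc k"] by simp
    finally show ?thesis using nz[of "Suc k"] by (simp add: eq_divide_eq)
  qed
  show "(\<Prod>k\<le>j. X ^ 2 * w k * w (Suc k)) = d 0 / (d (Suc j) * d (Suc (Suc j)))"
    by (induction j) (use d(2) nz in \<open>simp_all add: factor\<close>)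
qed

lemma orbit_telescope:
  fixes v :: "'a::field fps" and d :: "nat \<Rightarrow> 'a fls"
  assumes d: "d 0 = fls_X * fps_to_fls v" "d (Suc 0) = 1"
    "\<And>k. d (Suc (Suc k)) = d (Suc k) / fls_X - d k"
  shows "d (Suc k) \<noteq> 0"
    and "(\<Prod>k\<le>j. fps_to_fls (fps_X ^ 2 * orbit (fps_X ^ 2) v k * orbit (fps_X ^ 2) v (Suc k))) =
      d 0 / (d (Suc j) * d (Suc (Suc j)))"
proof -
  define w where "w k = fps_to_fls (orbit (fps_X ^ 2) v k)" for k
  have w: "w (Suc k) * (1 - fls_X ^ 2 * w k) = 1" for k
  proof -
    let ?u = "1 - fps_X ^ 2 * orbit (fps_X ^ 2) v k"
    have "inverse ?u * ?u = 1" by (rule inverse_mult_eq_1) simp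
    then have "fps_to_fls (inverse ?u * ?u) = 1" by (simp only: fps_one_to_fls)
    then show ?thesis by (simp add: w_def orbit_Suc fls_times_fps_to_fls fps_to_fls_power)
  qed
  have "d 0 = fls_X * w 0" by (simp add: d(1) w_def orbit_0)
  note telescoping_product[of fls_X w d, OF fls_X_nonzero w this d(2,3)]
  then show "d (Suc k) \<noteq> 0" and "(\<Prod>k\<le>j. fps_to_fls (fps_X ^ 2 * orbit (fps_X ^ 2) v k * orbit (fps_X ^ 2) v (Suc k))) =
      d 0 / (d (Suc j) * d (Suc (Suc j)))"
    by (simp_all add: w_def fls_times_fps_to_fls fps_to_fls_power)
qed

lemma functional_equation_sums_telescoped:
  fixes A :: "'a::field fps \<Rightarrow> 'a fps" and q :: 'a and d :: "nat \<Rightarrow> 'a fls"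
  assumes A: "\<And>u. A u = fps_const q * (fps_X ^ 2 * u * inverse (1 - fps_X ^ 2 * u)) *
      (A (inverse (1 - fps_X ^ 2 * u)) + E)"
    and E: "fps_nth E 0 \<noteq> 0" and q: "q \<noteq> 0"
    and d: "d 0 = fls_X * fps_to_fls v" "d (Suc 0) = 1"
      "\<And>k. d (Suc (Suc k)) = d (Suc k) / fls_X - d k"
  shows "(\<lambda>j. d 0 * fls_const q ^ j / (d (Suc (Suc j)) * d (Suc j))) sums
     (fps_to_fls (A v) / (fls_const q * fps_to_fls E))"
  using functional_equation_sums[OF refl A E q, of v] unfolding orbit_telescope(2)[OF d]
  by (simp add: mult_ac)

section \<open>The coefficients of the generating function\<close>

text \<open>
  The generating function over the avoided letter. In contrast to \<^const>\<open>A_gf\<close>, the avoided letter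
  may be 0 and the word may be empty: then the recurrence has no exceptional cases. The
  avoided letter 0 contributes only to the empty word, whose coefficient \<open>1 / (1 - q)\<close> is
  subtracted in the end.
\<close>

definition letter_gf :: "nat \<Rightarrow> nat \<Rightarrow> rat fps" where
  "letter_gf n t = Abs_fps (\<lambda>i. of_nat (a_count i n t))"

lemma letter_gf_no_zeros:
  "letter_gf n 0 = (if n = 0 then inverse (1 - fps_X) else 0)"
  by (auto simp: letter_gf_def a_count_no_zeros fps_inverse_one_minus_fps_X fps_eq_iff)

lemma letter_gf_rec:
  assumes "0 < t" "t \<le> n"
  shows "letter_gf n t = fps_X * (\<Sum>s\<le>n - t. of_nat (insertions s t) * letter_gf (n - t) s)"
proof (rule fps_ext)
  fix i
  show "fps_nth (letter_gf n t) i =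
      fps_nth (fps_X * (\<Sum>s\<le>n - t. of_nat (insertions s t) * letter_gf (n - t) s)) i"
  proof (cases i)
    case 0
    then show ?thesis using assms(1) by (simp add: letter_gf_def a_count_avoid_0)
  next
    case (Suc j)
    then show ?thesis
      using assms by (simp add: letter_gf_def a_count_Suc fps_sum_nth)
  qed
qed

text \<open>
  The same series as a constant of the coefficient field, whose own variable is \<open>w\<close>.
\<close>

definition letter_coeff :: "nat \<Rightarrow> nat \<Rightarrow> rat fls fls" where
  "letter_coeff n t = fls_const (fps_to_fls (letter_gf n t))"

lemma fls_const_sum: "fls_const (sum f A) = (\<Sum>a\<in>A. fls_const (f a))"
  by (induction A rule: infinite_finite_induct) (simp_all flip: fls_plus_const)

lemma letter_coeff_rec:
  assumes "0 < t" "t \<le> n"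
  shows "letter_coeff n t =
     fls_const fls_X * (\<Sum>s\<le>n - t. of_nat (insertions s t) * letter_coeff (n - t) s)"
  unfolding letter_coeff_def letter_gf_rec[OF assms]
  by (simp add: fls_times_fps_to_fls fps_to_fls_sum fls_of_nat fls_const_sum
      flip: fls_const_mult_const)

lemma letter_coeff_no_zeros:
  "letter_coeff n 0 = (if n = 0 then inverse (1 - fls_const fls_X) else 0)"
proof -
  have "fps_to_fls (inverse (1 - fps_X)) * (1 - fls_X) = (1 :: rat fls)"
  proof -
    have "inverse (1 - fps_X) * (1 - fps_X) = (1 :: rat fps)" by (rule inverse_mult_eq_1) simp
    then have "fps_to_fls (inverse (1 - fps_X) * (1 - fps_X :: rat fps)) = 1" by (simp only: fps_one_to_fls)
    then show ?thesis by (simp add: fls_times_fps_to_fls)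
  qed
  then have "fls_const (fps_to_fls (inverse (1 - fps_X :: rat fps)) * (1 - fls_X)) = (1 :: rat fls fls)"
    by simp
  then have "fls_const (fps_to_fls (inverse (1 - fps_X :: rat fps))) * (1 - fls_const fls_X) = (1 :: rat fls fls)"
    by (metis fls_const_mult_const fls_const_1 fls_minus_const)
  then have "inverse (1 - fls_const fls_X) = fls_const (fps_to_fls (inverse (1 - fps_X :: rat fps)))"
    by (intro inverse_unique) (simp only: mult.commute)
  then show ?thesis unfolding letter_coeff_def letter_gf_no_zeros by simp
qed

text \<open>
  The double series has \<open>w\<close> as a substituted value, whereas in \<^const>\<open>A_gf\<close> the coefficient of \<open>x^n\<close> is
  itself a series in \<open>w\<close>. Both agree because a word of length \<open>n\<close> has at most \<open>n\<close> zeros.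
\<close>

lemma letter_coeff_polynomial:
  "(\<Sum>t\<le>n. letter_coeff n t * fls_X ^ t) =
     fps_to_fls (Abs_fps (\<lambda>t. if t \<le> n then fps_to_fls (letter_gf n t) else 0))"
proof -
  have "Abs_fps (\<lambda>t. if t \<le> n then fps_to_fls (letter_gf n t) else 0) =
      (\<Sum>t\<le>n. fps_const (fps_to_fls (letter_gf n t)) * fps_X ^ t)"
    by (rule fps_ext) (simp add: fps_sum_nth if_distrib[of "\<lambda>a. _ * a"] cong: if_cong)
  then show ?thesis
    by (simp add: letter_coeff_def fps_to_fls_sum fls_times_fps_to_fls fps_to_fls_power)
qed

lemma A_gf_eq_eval_gf:
  "A_gf = fps_to_fls (eval_gf letter_coeff (fps_X ^ 2) (fps_const fls_X)
     - fps_const (inverse (1 - fls_const fls_X)))"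
proof -
  define F :: "rat fls fls fps" where "F = Abs_fps (\<lambda>n. fps_to_fls (Abs_fps (\<lambda>t. fps_to_fls (Abs_fps (\<lambda>i.
                if i \<ge> 1 \<and> t \<ge> 1 \<and> n \<ge> t then of_nat (a_count i n t) else 0)))))"
  define e :: "rat fls fls" where "e = inverse (1 - fls_const fls_X)"
  define P where "P n = (\<Sum>t\<le>n. letter_coeff n t * fls_X ^ t)" for n
  have inner: "Abs_fps (\<lambda>i. if i \<ge> 1 \<and> t \<ge> 1 \<and> n \<ge> t then of_nat (a_count i n t) else 0) =
      (if t = 0 then 0 else if t \<le> n then letter_gf n t else 0)" for n t
    by (cases "t = 0") (auto simp: letter_gf_def fps_eq_iff a_count_avoid_0 not_less_eq_eq)
  have P: "P n = fps_nth F n + (if n = 0 then e else 0)" for n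
  proof -
    have "P n = fps_to_fls (Abs_fps (\<lambda>t. if t \<le> n then fps_to_fls (letter_gf n t) else 0))"
      unfolding P_def by (rule letter_coeff_polynomial)
    also have "Abs_fps (\<lambda>t. if t \<le> n then fps_to_fls (letter_gf n t) else 0) =
      Abs_fps (\<lambda>t. fps_to_fls (if t = 0 then 0 else if t \<le> n then letter_gf n t else 0)) +
      fps_const (fps_to_fls (letter_gf n 0))"
      by (auto simp: fps_eq_iff)
    also have "fps_to_fls \<dots> = fps_nth F n + letter_coeff n 0"
      unfolding F_def inner by (simp add: letter_coeff_def)
    finally show ?thesis by (simp add: letter_coeff_no_zeros e_def)
  qed
  have "eval_gf letter_coeff (fps_X ^ 2) (fps_const fls_X) =
      fps_lsum (\<lambda>n. fps_const (fps_nth (Abs_fps P) n) * (fps_X ^ 2) ^ n)"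
    unfolding eval_gf_def P_def
    by (simp add: fps_const_sum mult.commute)
  also have "\<dots> = fps_compose (Abs_fps P) (fps_X ^ 2)" by (rule fps_lsum_compose)
  also have "Abs_fps P = F + fps_const e" by (simp add: fps_eq_iff P)
  finally have "fps_compose F (fps_X ^ 2) = eval_gf letter_coeff (fps_X ^ 2) (fps_const fls_X) - fps_const e"
    by (simp add: fps_compose_add_distrib)
  moreover have "A_gf = fps_to_fls (fps_compose F (fps_X ^ 2))"
    unfolding A_gf_def F_def[symmetric] by (rule fls_compose_power_fps_to_fls) simp
  ultimately show ?thesis by (simp add: e_def)
qed

section \<open>The formula with Chebyshev polynomials\<close>

lemma cheb_U_rec: "n \<ge> 0 \<Longrightarrow> cheb_U (n + 1) y = 2 * y * cheb_U n y - cheb_U (n - 1) y"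
proof -
  assume "n \<ge> 0"
  then obtain m where "n = int m" by (metis nonneg_int_cases)
  then show ?thesis by (cases m) (simp_all add: cheb_U_def nat_add_distrib)
qed

theorem theorem3p3:
  fixes t :: series
  assumes "t = 1 / (2 * sqrt_x)"
  shows
    "(\<forall>j::nat. cheb_U (int j + 1) t - var_w * sqrt_x * cheb_U (int j) t \<noteq> 0 \<and>
               cheb_U (int j) t - var_w * sqrt_x * cheb_U (int j - 1) t \<noteq> 0 \<and>
               sqrt_x * cheb_U (int j + 2) t * cheb_U (int j + 1) t \<noteq> 0) \<and>
     summable (\<lambda>j::nat. var_w * sqrt_x * var_q ^ j /
        ((cheb_U (int j + 1) t - var_w * sqrt_x * cheb_U (int j) t) *
         (cheb_U (int j) t - var_w * sqrt_x * cheb_U (int j - 1) t))) \<and>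
     summable (\<lambda>j::nat. var_q ^ j / (sqrt_x * cheb_U (int j + 2) t * cheb_U (int j + 1) t)) \<and>
     (1 - var_q) * (1 + var_q * (\<Sum>j::nat.
        var_q ^ j / (sqrt_x * cheb_U (int j + 2) t * cheb_U (int j + 1) t))) \<noteq> 0 \<and>
     A_gf =
       (var_q * (\<Sum>j::nat. var_w * sqrt_x * var_q ^ j /
          ((cheb_U (int j + 1) t - var_w * sqrt_x * cheb_U (int j) t) *
           (cheb_U (int j) t - var_w * sqrt_x * cheb_U (int j - 1) t)))) /
       ((1 - var_q) * (1 + var_q * (\<Sum>j::nat.
          var_q ^ j / (sqrt_x * cheb_U (int j + 2) t * cheb_U (int j + 1) t))))"
proof -
  define q :: "rat fls fls" where "q = fls_const fls_X"
  define e where "e = inverse (1 - q)"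
  \<comment> \<open>The contribution \<open>e\<close> of the empty word is removed.\<close>
  define A where "A v = eval_gf letter_coeff (fps_X ^ 2) v - fps_const e" for v
  define E where "E = fps_const e - A 1"
  have q0: "q \<noteq> 0" by (simp add: q_def)
  have q1: "1 - q \<noteq> 0"
  proof -
    have "fls_nth (fls_nth (1 - q) 0) 0 = 1" by (simp add: q_def)
    then show ?thesis by auto
  qed
  have A: "A u = fps_const q * (fps_X ^ 2 * u * inverse (1 - fps_X ^ 2 * u)) *
      (A (inverse (1 - fps_X ^ 2 * u)) + E)" for u
    unfolding E_def A_def
    by (subst eval_gf_functional_equation[where c = letter_coeff and e = e and q = q])
       (simp_all add: letter_coeff_no_zeros letter_coeff_rec q_def e_def)
  have E0: "fps_nth E 0 \<noteq> 0"
    unfolding E_def using q1 by (simp add: A[of 1] e_def)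
  have X: "fls_X = sqrt_x" and Q: "fls_const q = var_q" and W: "fps_to_fls (fps_const fls_X) = var_w"
    by (simp_all add: sqrt_x_def q_def var_q_def var_w_def)
  have x0: "sqrt_x \<noteq> 0" by (simp add: sqrt_x_def)
  have U: "cheb_U (n + 1) t = cheb_U n t / sqrt_x - cheb_U (n - 1) t" if "n \<ge> 0" for n
    using cheb_U_rec[OF that, of t] assms by simp
  have U0: "cheb_U 0 t = 1" and Um: "cheb_U (- 1) t = 0" by (simp_all add: cheb_U_def)
  \<comment> \<open>The case \<open>k = 0\<close> is the value that \<open>U_(-2) = -1\<close> gives in the second case; it is separate because
    \<open>cheb_U\<close> has the value 0 at \<open>-2\<close>.\<close>
  define d where "d V k = (if k = 0 then sqrt_x * V
      else cheb_U (int k - 1) t - V * sqrt_x * cheb_U (int k - 2) t)" for V k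
  have d0: "d V 0 = sqrt_x * V" and d1: "d V (Suc 0) = 1" for V by (simp_all add: d_def U0 Um)
  have d2: "d V (Suc (Suc k)) = d V (Suc k) / sqrt_x - d V k" for V k
  proof (cases k)
    case 0
    then show ?thesis using U[of 0] by (simp add: d_def U0 Um mult.commute)
  next
    case (Suc j)
    have U2: "cheb_U (int j + 2) t = cheb_U (int j + 1) t / sqrt_x - cheb_U (int j) t"
      using U[of "int j + 1"] by (simp add: add.commute)
    have "sqrt_x * cheb_U (int j + 1) t = cheb_U (int j) t - sqrt_x * cheb_U (int j - 1) t"
      using U[of "int j"] x0 by (simp add: field_simps)
    then have U1: "V * sqrt_x * cheb_U (int j + 1) t =
        V * cheb_U (int j) t - V * sqrt_x * cheb_U (int j - 1) t"
      by (simp add: mult.assoc right_diff_distrib)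
    have "d V (Suc (Suc k)) = cheb_U (int j + 2) t - V * sqrt_x * cheb_U (int j + 1) t"
      by (simp add: d_def Suc algebra_simps)
    also have "\<dots> = (cheb_U (int j + 1) t - V * sqrt_x * cheb_U (int j) t) / sqrt_x -
        (cheb_U (int j) t - V * sqrt_x * cheb_U (int j - 1) t)"
      unfolding U1 U2 using x0 by (simp add: diff_divide_distrib)
    also have "\<dots> = d V (Suc k) / sqrt_x - d V k"
      by (simp add: d_def Suc algebra_simps)
    finally show ?thesis .
  qed
  have dnz: "d (fps_to_fls v) (Suc k) \<noteq> 0" for v k
    by (rule orbit_telescope(1)[where v = v]) (simp_all add: d0 d1 d2 X)
  have sums: "(\<lambda>j. d (fps_to_fls v) 0 * var_q ^ j / (d (fps_to_fls v) (Suc (Suc j)) * d (fps_to_fls v) (Suc j))) sums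
     (fps_to_fls (A v) / (var_q * fps_to_fls E))" for v
    unfolding Q[symmetric]
    by (rule functional_equation_sums_telescoped[where d = "d (fps_to_fls v)", OF A E0 q0]) (simp_all add: d0 d1 d2 X)

  define S where "S j = var_w * sqrt_x * var_q ^ j /
        ((cheb_U (int j + 1) t - var_w * sqrt_x * cheb_U (int j) t) *
         (cheb_U (int j) t - var_w * sqrt_x * cheb_U (int j - 1) t))" for j
  define T where "T j = var_q ^ j / (sqrt_x * cheb_U (int j + 2) t * cheb_U (int j + 1) t)" for j
  have dw: "d var_w (Suc j) = cheb_U (int j) t - var_w * sqrt_x * cheb_U (int j - 1) t" for j
    by (simp add: d_def)
  \<comment> \<open>At \<open>V = 1\<close> the recurrence of the Chebyshev polynomials applies once more; this is why the indices
    in the denominator of the formula are shifted by one.\<close>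
  have d_one: "d 1 (Suc j) = sqrt_x * cheb_U (int j + 1) t" for j
    using U[of "int j"] x0 by (simp add: d_def field_simps)
  have S: "S sums (fps_to_fls (A (fps_const fls_X)) / (var_q * fps_to_fls E))"
    using sums[of "fps_const fls_X"] unfolding W dw d0 S_def by (simp add: mult_ac add_ac)
  have T: "T sums (fps_to_fls (A 1) / (var_q * fps_to_fls E))"
    using sums[of 1] x0 unfolding T_def fps_one_to_fls d_one d0 by (simp add: mult_ac add_ac)
  have wnz: "cheb_U (int j) t - var_w * sqrt_x * cheb_U (int j - 1) t \<noteq> 0" for j
    using dnz[of "fps_const fls_X" j] unfolding W dw .
  have unz: "cheb_U (int j + 1) t \<noteq> 0" for j
    using dnz[of 1 j] unfolding fps_one_to_fls d_one by simp
  have nz: "var_q \<noteq> 0" "fps_to_fls E \<noteq> 0" "1 - var_q \<noteq> 0"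
  proof -
    show "var_q \<noteq> 0" using q0 by (simp add: Q[symmetric])
    show "fps_to_fls E \<noteq> 0" using E0 by auto
    have "1 - var_q = fls_const (1 - q)" by (simp add: Q[symmetric] flip: fls_minus_const)
    then show "1 - var_q \<noteq> 0" using q1 by simp
  qed
  \<comment> \<open>The value at \<open>V = 1\<close> determines the unknown \<open>E\<close>, because \<open>E + A 1 = 1 / (1 - q)\<close>.\<close>
  have key: "(1 - var_q) * (1 + var_q * suminf T) = 1 / fps_to_fls E"
  proof -
    have "(1 - var_q) * (fps_to_fls E + fps_to_fls (A 1)) = 1"
    proof -
      have "fps_to_fls E + fps_to_fls (A 1) = fls_const e" by (simp add: E_def)
      moreover have "(1 - var_q) * fls_const e = fls_const ((1 - q) * e)"
        by (simp add: Q[symmetric] left_diff_distrib flip: fls_minus_const)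
      ultimately show ?thesis using q1 by (simp add: e_def)
    qed
    then have "(1 - var_q) * ((fps_to_fls E + fps_to_fls (A 1)) / fps_to_fls E) = 1 / fps_to_fls E"
      by simp
    moreover have "1 + var_q * suminf T = (fps_to_fls E + fps_to_fls (A 1)) / fps_to_fls E"
      unfolding sums_unique[OF T, symmetric] using nz by (simp add: add_divide_distrib)
    ultimately show ?thesis by simp
  qed
  have main: "A_gf = var_q * suminf S / ((1 - var_q) * (1 + var_q * suminf T))"
    unfolding key sums_unique[OF S, symmetric] A_gf_eq_eval_gf
    using nz by (simp add: A_def e_def q_def)
  have "cheb_U (int j + 1) t - var_w * sqrt_x * cheb_U (int j) t \<noteq> 0" for j
    using wnz[of "Suc j"] by (simp add: add.commute)
  moreover have "sqrt_x * cheb_U (int j + 2) t * cheb_U (int j + 1) t \<noteq> 0" for j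
    using unz[of j] unz[of "Suc j"] x0 by (simp add: add_ac)
  moreover have "(1 - var_q) * (1 + var_q * suminf T) \<noteq> 0" unfolding key using nz by simp
  ultimately show ?thesis
    using wnz main sums_summable[OF S] sums_summable[OF T] unfolding S_def T_def by blast
qed

end
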